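(* There exists a triple $\varphi=(\varphi_1,\varphi_2,\varphi_3)$ of density matrices on $\mathbb{C}^4$ such that $\operatorname{Tr}(\varphi_1\varphi_2\varphi_3)\in\mathbb{R}$ but $\varphi$ is not imaginarity-free, i.e. $\varphi\notin\mathcal{R}_3(\mathbb{C}^4)$; moreover, $\varphi$ can be chosen so that $\operatorname{Im}[\operatorname{Tr}(\varphi_1^2\varphi_2\varphi_3)]\neq 0$.
   Context: A density matrix is a positive semidefinite matrix of trace one. A triple $(\varphi_1,\varphi_2,\varphi_3)$ of density matrices on $\mathbb{C}^d$ is imaginarity-free if there is an orthonormal basis $\{|a_i\rangle\}_{i=1}^d$ of $\mathbb{C}^d$ such that $\langle a_i|\varphi_k|a_j\rangle\in\mathbb{R}$ for all $i,j$ and all $k$; $\mathcal{R}_3(\mathbb{C}^d)$ denotes the set of imaginarity-free triples. *)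

theory Defs
  imports "HOL-Analysis.Analysis"
begin

text \<open>
  The library's inner product on \<open>complex ^ 'd\<close> is the real-valued one of the underlying
  real Euclidean space, so the sesquilinear product \<open>\<langle>v|w\<rangle>\<close> (antilinear in the first
  argument) is introduced here.
\<close>

definition cinner :: "complex ^ 'd \<Rightarrow> complex ^ 'd \<Rightarrow> complex" where
  "cinner v w = (\<Sum>i\<in>UNIV. cnj (v $ i) * w $ i)"

definition braket :: "complex ^ 'd \<Rightarrow> complex ^ 'd ^ 'd \<Rightarrow> complex ^ 'd \<Rightarrow> complex" where
  "braket v A w = cinner v (A *v w)"

definition hermitian :: "complex ^ 'd ^ 'd \<Rightarrow> bool" where
  "hermitian A \<longleftrightarrow> (\<forall>i j. A $ i $ j = cnj (A $ j $ i))"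

definition positive_semidefinite :: "complex ^ 'd ^ 'd \<Rightarrow> bool" where
  "positive_semidefinite A \<longleftrightarrow> hermitian A \<and> (\<forall>v. braket v A v \<in> \<real>\<^sub>\<ge>\<^sub>0)"

definition density_matrix :: "complex ^ 'd ^ 'd \<Rightarrow> bool" where
  "density_matrix A \<longleftrightarrow> positive_semidefinite A \<and> trace A = 1"

text \<open>Here \<open>vec.span\<close> is the span with complex coefficients, unlike the plain \<open>span\<close>.\<close>

definition orthonormal_basis :: "('d \<Rightarrow> complex ^ 'd) \<Rightarrow> bool" where
  "orthonormal_basis a \<longleftrightarrow>
     (\<forall>i j. cinner (a i) (a j) = (if i = j then 1 else 0)) \<and> vec.span (range a) = UNIV"

definition imaginarity_free_triples ::
    "((complex ^ 'd ^ 'd) \<times> (complex ^ 'd ^ 'd) \<times> (complex ^ 'd ^ 'd)) set" where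
  "imaginarity_free_triples =
     {(\<phi>\<^sub>1, \<phi>\<^sub>2, \<phi>\<^sub>3).
        density_matrix \<phi>\<^sub>1 \<and> density_matrix \<phi>\<^sub>2 \<and> density_matrix \<phi>\<^sub>3 \<and>
        (\<exists>a. orthonormal_basis a \<and>
          (\<forall>i j. \<forall>\<psi>\<in>{\<phi>\<^sub>1, \<phi>\<^sub>2, \<phi>\<^sub>3}. braket (a i) \<psi> (a j) \<in> \<real>))}"

end

(* If an orthonormal basis makes all three matrices real, then every word in them has real trace.
   Take D = diag(d) and the projections onto u = (1,1,1,0) and w.  Up to positive factors, the
   trace of D^k times the two projections is (sum of w_i) times the conjugate of the sum of
   d_i^k w_i.  The imaginary part (1,-2,1,0) of w is the second difference on d = (0,1,2):
   it annihilates 1 and d, but not d^2. *)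
theory Submission imports Defs begin

lemma braket_eq_sum:
  "braket v A w = (\<Sum>i\<in>UNIV. \<Sum>j\<in>UNIV. cnj (v $ i) * A $ i $ j * w $ j)"
  by (simp add: braket_def cinner_def matrix_vector_mult_def sum_distrib_left mult.assoc)

definition diagonal_matrix :: "('d \<Rightarrow> real) \<Rightarrow> complex ^ 'd ^ 'd" where
  "diagonal_matrix d = (\<chi> i j. if i = j then of_real (d i) else 0)"

definition outer_product :: "complex ^ 'd \<Rightarrow> complex ^ 'd ^ 'd" where
  "outer_product x = (\<chi> i j. x $ i * cnj (x $ j))"

lemma positive_semidefinite_diagonal_matrix:
  assumes "\<And>i. 0 \<le> d i"
  shows "positive_semidefinite (diagonal_matrix d)"
proof -
  have "braket v (diagonal_matrix d) v = of_real (\<Sum>i\<in>UNIV. d i * (cmod (v $ i))\<^sup>2)" for v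
    unfolding of_real_sum of_real_mult complex_norm_square
    by (simp add: braket_eq_sum diagonal_matrix_def if_distrib if_distribR mult_ac cong: if_cong)
  moreover have "0 \<le> (\<Sum>i\<in>UNIV. d i * (cmod (v $ i))\<^sup>2)" for v :: "complex ^ 'a"
    by (intro sum_nonneg mult_nonneg_nonneg assms) auto
  ultimately have "braket v (diagonal_matrix d) v \<in> \<real>\<^sub>\<ge>\<^sub>0" for v
    by (metis nonneg_Reals_of_real_iff)
  then show ?thesis
    by (auto simp: positive_semidefinite_def hermitian_def diagonal_matrix_def)
qed

text \<open>The quadratic form at \<open>v\<close> is the squared modulus of
  \<open>cinner x v\<close>. The length of \<open>x\<close> matters only for the trace, which is
  checked later for each state.\<close>

lemma positive_semidefinite_outer_product: "positive_semidefinite (outer_product x)"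
proof -
  have "braket v (outer_product x) v = cnj (cinner x v) * cinner x v" for v
    unfolding braket_eq_sum
    by (subst sum.swap) (simp add: outer_product_def cinner_def sum_product mult_ac)
  then have "braket v (outer_product x) v = of_real ((cmod (cinner x v))\<^sup>2)" for v
    by (metis complex_norm_square mult.commute)
  then have "braket v (outer_product x) v \<in> \<real>\<^sub>\<ge>\<^sub>0" for v
    by (metis nonneg_Reals_of_real_iff zero_le_power2)
  then show ?thesis
    by (simp add: positive_semidefinite_def hermitian_def outer_product_def mult.commute)
qed

lemma real_matrix_mult:
  fixes A B :: "complex ^ 'd ^ 'd"
  assumes "\<And>i j. A $ i $ j \<in> \<real>" "\<And>i j. B $ i $ j \<in> \<real>"
  shows "(A ** B) $ i $ j \<in> \<real>"
  unfolding matrix_matrix_mult_def by (auto intro!: sum_in_Reals Reals_mult assms)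

text \<open>A change to the basis that makes all three matrices real is a unitary conjugation. It
  respects products and preserves the trace, and words in real matrices have real trace.\<close>

lemma imaginarity_free_trace_real:
  fixes A B C :: "complex ^ 'd ^ 'd"
  assumes "(A, B, C) \<in> imaginarity_free_triples"
  shows "trace (A ** A ** B ** C) \<in> \<real>"
proof -
  obtain a :: "'d \<Rightarrow> complex ^ 'd"
    where ortho: "\<And>i j. cinner (a i) (a j) = (if i = j then 1 else 0)"
      and real: "\<And>i j M. M \<in> {A, B, C} \<Longrightarrow> braket (a i) M (a j) \<in> \<real>"
    using assms unfolding imaginarity_free_triples_def orthonormal_basis_def by blast
  define U :: "complex ^ 'd ^ 'd" where "U = (\<chi> i j. a j $ i)"
  \<comment> \<open>\<open>V\<close> is the conjugate transpose of \<open>U\<close>, whose columns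
    are the basis vectors, so the entries of \<open>V ** U\<close> are the inner products in
    \<open>ortho\<close>.\<close>
  define V :: "complex ^ 'd ^ 'd" where "V = (\<chi> i j. cnj (a i $ j))"
  have "V ** U = mat 1"
    using ortho by (simp add: vec_eq_iff U_def V_def matrix_matrix_mult_def mat_def cinner_def)
  then have UV: "U ** V = mat 1"
    by (simp add: matrix_left_right_inverse)
  define T where "T M = V ** M ** U" for M
  have entry: "T M $ i $ j = braket (a i) M (a j)" for M i j
    \<comment> \<open>The outer sum runs over the column index of \<open>M\<close> in
      \<open>T M\<close>, but over its row index in \<open>braket_eq_sum\<close>; the swap aligns
      them.\<close>
    unfolding braket_eq_sum T_def
    by (subst sum.swap) (simp add: U_def V_def matrix_matrix_mult_def sum_distrib_right)
  \<comment> \<open>Insert \<open>U ** V = mat 1\<close> between \<open>M\<close> and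
    \<open>N\<close>.\<close>
  have T_mult: "T (M ** N) = T M ** T N" for M N
    unfolding T_def by (metis UV matrix_mul_assoc matrix_mul_rid)
  have T_real: "T M $ i $ j \<in> \<real>" if "M \<in> {A, B, C}" for M i j
    unfolding entry using that by (rule real)
  have "trace (T (A ** A ** B ** C)) \<in> \<real>"
    unfolding trace_def T_mult by (intro sum_in_Reals real_matrix_mult T_real) auto
  also have "trace (T (A ** A ** B ** C)) = trace (A ** A ** B ** C)"
    unfolding T_def by (metis UV matrix_mul_assoc matrix_mul_lid trace_mul_sym)
  finally show ?thesis .
qed

theorem mainTheorem7:
  "\<exists>\<phi>\<^sub>1 \<phi>\<^sub>2 \<phi>\<^sub>3 :: complex ^ 4 ^ 4.
     density_matrix \<phi>\<^sub>1 \<and> density_matrix \<phi>\<^sub>2 \<and> density_matrix \<phi>\<^sub>3 \<and>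
     trace (\<phi>\<^sub>1 ** \<phi>\<^sub>2 ** \<phi>\<^sub>3) \<in> \<real> \<and>
     (\<phi>\<^sub>1, \<phi>\<^sub>2, \<phi>\<^sub>3) \<notin> imaginarity_free_triples \<and>
     Im (trace (\<phi>\<^sub>1 ** \<phi>\<^sub>1 ** \<phi>\<^sub>2 ** \<phi>\<^sub>3)) \<noteq> 0"
proof -
  \<comment> \<open>This is (0,1,2) divided by 3 to get trace one. The fourth coordinate is zero
    padding in \<open>d\<close>, \<open>u\<close> and \<open>w\<close>.\<close>
  define d :: "4 \<Rightarrow> real" where "d = (\<lambda>i. if i = 2 then 1/3 else if i = 3 then 2/3 else 0)"
  define u :: "complex ^ 4" where "u = (\<chi> i. if i = 4 then 0 else of_real (1 / sqrt 3))"
  \<comment> \<open>\<open>w\<close> is ((1,1,1,0) + i(1,-2,1,0))/3, of squared norm 3/9 + 6/9 = 1.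
    The real part makes its entries sum to 1, so this factor of the traces does not vanish.\<close>
  define w :: "complex ^ 4"
    where "w = (\<chi> i. if i = 4 then 0 else if i = 2 then Complex (1/3) (-2/3) else Complex (1/3) (1/3))"
  define D where "D = diagonal_matrix d"
  define P where "P = outer_product u"
  define Q where "Q = outer_product w"
  have P_entry: "P $ i $ j = (if i = 4 \<or> j = 4 then 0 else 1/3)" for i j
    by (simp add: P_def outer_product_def u_def flip: of_real_mult)
  have D: "density_matrix D"
    unfolding density_matrix_def D_def
    by (intro conjI positive_semidefinite_diagonal_matrix)
       (simp_all add: d_def trace_def diagonal_matrix_def sum_4)
  have P: "density_matrix P"
    unfolding density_matrix_def
    by (simp add: P_entry trace_def sum_4) (simp add: P_def positive_semidefinite_outer_product)
  have Q: "density_matrix Q"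
    unfolding density_matrix_def Q_def
    by (simp add: positive_semidefinite_outer_product)
       (simp add: outer_product_def w_def trace_def sum_4 complex_eq_iff)
  note entries = trace_def matrix_matrix_mult_def sum_4 P_entry D_def diagonal_matrix_def d_def
    Q_def outer_product_def w_def
  have DPQ: "trace (D ** P ** Q) \<in> \<real>"
    by (simp add: entries complex_is_Real_iff)
  \<comment> \<open>The imaginary part is -2/81: with the squares (0,1,4)/9 the second difference no
    longer cancels.\<close>
  have DDPQ: "Im (trace (D ** D ** P ** Q)) \<noteq> 0"
    by (simp add: entries)
  then have "(D, P, Q) \<notin> imaginarity_free_triples"
    using imaginarity_free_trace_real by (auto simp: complex_is_Real_iff)
  with D P Q DPQ DDPQ show ?thesis by blast
qed

end
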